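(* Let $v\ge 1$ be an integer, $\rho>0$, $\lambda\in(0,\infty)^v$, and let $\mu\in(0,\infty)^v$ be given by $\mu_k=\lambda_k\,\alpha_k(\rho;\lambda)/\alpha(\rho;\lambda)$ for $k=1,\dots,v$. Define a sequence $(\lambda^{(n)})_{n\ge 0}$ in $(0,\infty)^v$ by $$\lambda^{(0)}=\mu,\qquad \lambda^{(n+1)}_k=\mu_k\,\frac{\alpha(\rho;\lambda^{(n)})}{\alpha_k(\rho;\lambda^{(n)})},\qquad k=1,\dots,v,\quad n=0,1,2,\dots$$ Then the sequence converges and $\lim_{n\to\infty}\lambda^{(n)}=\lambda$.
   Context: $\mathcal{B}_v(\rho)=\{x\in\mathbb{R}^v:\ x^{T}x\le\rho\}$. For $\eta>0$ and $y\in\mathbb{R}$, $\delta(y,\eta)=\frac{1}{\sqrt{2\pi\eta}}\exp\{-\frac{y^2}{2\eta}\}$. For $\lambda\in(0,\infty)^v$, $$\alpha(\rho;\lambda)=\int_{\mathcal{B}_v(\rho)}d^vx\,\prod_{m=1}^v\delta(x_m,\lambda_m),\qquad \alpha_k(\rho;\lambda)=\int_{\mathcal{B}_v(\rho)}d^vx\,\frac{x_k^2}{\lambda_k}\prod_{m=1}^v\delta(x_m,\lambda_m).$$ *)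

theory Defs
  imports "HOL-Analysis.Analysis"
begin

definition sq_ball :: "real \<Rightarrow> (real ^ 'v) set" where
  "sq_ball \<rho> = {x. x \<bullet> x \<le> \<rho>}"

(* The parameter eta is the variance, not the standard deviation. *)
definition gauss :: "real \<Rightarrow> real \<Rightarrow> real" where
  "gauss y \<eta> = 1 / sqrt (2 * pi * \<eta>) * exp (- (y\<^sup>2 / (2 * \<eta>)))"

definition alpha :: "real \<Rightarrow> real ^ 'v \<Rightarrow> real" where
  "alpha \<rho> l = (LINT x:sq_ball \<rho>|lborel. (\<Prod>m\<in>UNIV. gauss (x $ m) (l $ m)))"

definition alpha_k :: "'v \<Rightarrow> real \<Rightarrow> real ^ 'v \<Rightarrow> real" where
  "alpha_k k \<rho> l =
     (LINT x:sq_ball \<rho>|lborel. (x $ k)\<^sup>2 / l $ k * (\<Prod>m\<in>UNIV. gauss (x $ m) (l $ m)))"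

end

(*
  Put t = 1/lambda, Z(t) = integral over the ball of exp(-1/2 sum_k t_k x_k^2), and let M_k(t) be the mean
  of x_k^2 under the corresponding truncated Gaussian. Then alpha_k/alpha = t_k M_k(t), and the iteration
  reads t_k' = t_k M_k(t) / M_k(a) with a = 1/lam.

  ln Z is convex in t, and by the Prekopa-Leindler inequality (applied in logarithmic coordinates on both
  the parameters and the variables) it is concave in ln t. Combining the two tangent inequalities shows
  that the weighted Kullback-Leibler divergence
    D(t) = sum_k M_k(a) (a_k ln(a_k/t_k) - a_k + t_k)
  drops in every step by at least twice the convexity gap
    ln Z(t) - ln Z(a) + 1/2 sum_k M_k(a) (t_k - a_k),
  which is positive unless t = a. Boundedness of D confines the iterates to a compact box of positive
  vectors, on which the gap tends to 0, so a is their only limit point.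
*)
theory Submission
  imports Defs
begin

section \<open>The Prekopa-Leindler inequality for geometric means\<close>

lemma emeasure_lborel_translate:
  fixes a :: real
  assumes [measurable]: "S \<in> sets borel"
  shows "(\<lambda>x. a + x) ` S \<in> sets borel" "emeasure lborel ((\<lambda>x. a + x) ` S) = emeasure lborel S"
proof -
  have eq: "(\<lambda>x. a + x) ` S = {x. - a + x \<in> S}"
  proof (intro equalityI subsetI)
    fix x assume "x \<in> {x. - a + x \<in> S}"
    then show "x \<in> (\<lambda>x. a + x) ` S"
      by (intro image_eqI[of _ _ "- a + x"]) auto
  qed auto
  have *: "{x. - a + x \<in> S} \<in> sets borel"
    by measurable
  show "(\<lambda>x. a + x) ` S \<in> sets borel"
    unfolding eq by (rule *)
  have "emeasure lborel S = emeasure (distr lborel borel (\<lambda>x. - a + x)) S"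
    by (simp only: lborel_distr_plus)
  also have "\<dots> = emeasure lborel {x. - a + x \<in> S}"
    by (subst emeasure_distr) (auto simp: vimage_def)
  finally show "emeasure lborel ((\<lambda>x. a + x) ` S) = emeasure lborel S"
    unfolding eq ..
qed

text \<open>Translating \<open>S\<close> by the least point of \<open>T\<close>, and
  \<open>T\<close> by the greatest point of \<open>S\<close>, places both copies inside the sumset,
  where they share at most the point \<open>s + t\<close>; so their lengths add up.\<close>

lemma compact_sumset_measure:
  fixes S T U :: "real set"
  assumes S: "compact S" "S \<noteq> {}" and T: "compact T" "T \<noteq> {}"
    and U: "U \<in> sets borel" and sub: "\<And>x y. x \<in> S \<Longrightarrow> y \<in> T \<Longrightarrow> x + y \<in> U"
  shows "emeasure lborel S + emeasure lborel T \<le> emeasure lborel U"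
proof -
  obtain s where s: "s \<in> S" "\<And>x. x \<in> S \<Longrightarrow> x \<le> s"
    using compact_attains_sup[OF S] by blast
  obtain t where t: "t \<in> T" "\<And>y. y \<in> T \<Longrightarrow> t \<le> y"
    using compact_attains_inf[OF T] by blast
  let ?S = "(\<lambda>x. t + x) ` S" and ?T = "(\<lambda>y. s + y) ` T"
  have meas: "S \<in> sets borel" "T \<in> sets borel"
    using S T by (auto intro: borel_compact)
  have cut: "?S \<inter> ?T \<subseteq> {s + t}"
  proof
    fix z assume "z \<in> ?S \<inter> ?T"
    then obtain x y where "x \<in> S" "y \<in> T" "z = t + x" "z = s + y" by blast
    then show "z \<in> {s + t}"
      using s(2)[of x] t(2)[of y] by auto
  qed
  have sets: "?S \<in> sets lborel" "?T \<in> sets lborel"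
    using meas by (simp_all only: emeasure_lborel_translate(1) sets_lborel)
  have "{s + t} \<in> null_sets lborel"
    by (intro finite_imp_null_set_lborel) simp
  then have null: "emeasure lborel (?S \<inter> ?T) = 0"
    using null_sets_subset[OF _ sets.Int[OF sets] cut] by blast
  have "emeasure lborel S + emeasure lborel T = emeasure lborel ?S + emeasure lborel ?T"
    using meas by (simp only: emeasure_lborel_translate(2))
  also have "\<dots> = emeasure lborel (?S \<union> ?T) + emeasure lborel (?S \<inter> ?T)"
    using sets by (rule emeasure_Un_Int)
  also have "\<dots> \<le> emeasure lborel U"
  proof -
    have "?S \<union> ?T \<subseteq> U"
      using sub[OF s(1)] sub[OF _ t(1)] by (auto simp: add.commute[of t])
    then show ?thesis
      using U by (simp add: null emeasure_mono)
  qed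
  finally show ?thesis .
qed

text \<open>Inner regularity reduces this to compact sets. The measurable superset \<open>U\<close>
  stands in for the sumset itself, which need not be Borel; in the application it is a superlevel
  set.\<close>

lemma sumset_measure:
  fixes S T U :: "real set"
  assumes S: "S \<in> sets borel" "bounded S" "S \<noteq> {}" and T: "T \<in> sets borel" "bounded T" "T \<noteq> {}"
    and U: "U \<in> sets borel" and sub: "\<And>x y. x \<in> S \<Longrightarrow> y \<in> T \<Longrightarrow> x + y \<in> U"
  shows "emeasure lborel S + emeasure lborel T \<le> emeasure lborel U"
proof -
  have inner: "\<exists>K. compact K \<and> K \<noteq> {} \<and> K \<subseteq> A \<and> emeasure lborel A \<le> emeasure lborel K + ennreal e"
    if A: "A \<in> sets borel" "bounded A" "A \<noteq> {}" and e: "e > 0" for A :: "real set" and e :: real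
  proof -
    have Al: "A \<in> sets lebesgue" using A(1) by simp
    obtain K where K: "closed K" "K \<subseteq> A" "A - K \<in> lmeasurable" "emeasure lebesgue (A - K) < ennreal e"
      by (rule sets_lebesgue_inner_closed[OF Al e])
    obtain a where a: "a \<in> A" using A(3) by blast
    \<comment> \<open>\<open>K\<close> may be empty, whereas the compact case requires nonempty
      sets; adding a point of \<open>A\<close> repairs this.\<close>
    let ?K = "insert a K"
    have meas: "K \<in> sets borel" "?K \<in> sets borel"
      using borel_closed[OF K(1)] by auto
    have "emeasure lborel A = emeasure lborel (?K \<union> (A - ?K))"
      using K a by (intro arg_cong[where f="emeasure lborel"]) blast
    also have "\<dots> = emeasure lborel ?K + emeasure lborel (A - ?K)"
      using A(1) meas by (intro plus_emeasure[symmetric]) auto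
    also have "emeasure lborel (A - ?K) \<le> emeasure lborel (A - K)"
      using A(1) meas by (intro emeasure_mono) auto
    also have "emeasure lborel (A - K) = emeasure lebesgue (A - K)"
      using A(1) meas by simp
    also have "\<dots> \<le> ennreal e" using K(4) by (rule less_imp_le)
    finally have "emeasure lborel A \<le> emeasure lborel ?K + ennreal e"
      by (simp only: add_left_mono)
    moreover have "compact ?K"
      using bounded_subset[OF A(2) K(2)] K(1) by (simp add: compact_eq_bounded_closed)
    moreover have "?K \<noteq> {}" "?K \<subseteq> A"
      using a K(2) by auto
    ultimately show ?thesis by blast
  qed
  show ?thesis
  proof (rule ennreal_le_epsilon)
    fix e :: real assume e: "e > 0"
    then have e2: "e/2 > 0" by simp
    obtain K where K: "compact K" "K \<noteq> {}" "K \<subseteq> S" "emeasure lborel S \<le> emeasure lborel K + ennreal (e/2)"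
      using inner[OF S e2] by blast
    obtain L where L: "compact L" "L \<noteq> {}" "L \<subseteq> T" "emeasure lborel T \<le> emeasure lborel L + ennreal (e/2)"
      using inner[OF T e2] by blast
    have "emeasure lborel S + emeasure lborel T
        \<le> (emeasure lborel K + emeasure lborel L) + (ennreal (e/2) + ennreal (e/2))"
      using add_mono[OF K(4) L(4)] by (simp add: ac_simps)
    also have "ennreal (e/2) + ennreal (e/2) = ennreal e"
      using e by (simp flip: ennreal_plus)
    also have "emeasure lborel K + emeasure lborel L \<le> emeasure lborel U"
      by (rule compact_sumset_measure[OF K(1,2) L(1,2) U]) (use K(3) L(3) sub in blast)
    finally show "emeasure lborel S + emeasure lborel T \<le> emeasure lborel U + ennreal e"
      by (simp add: add_right_mono)
  qed
qed

section \<open>The layer cake formula and the additive Prekopa-Leindler inequality\<close>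

lemma nn_integral_layer_cake:
  fixes f :: "real \<Rightarrow> ennreal"
  assumes [measurable]: "f \<in> borel_measurable borel"
  shows "(\<integral>\<^sup>+x. f x \<partial>lborel) = (\<integral>\<^sup>+r. indicator {0<..} r * emeasure lborel {x. ennreal r < f x} \<partial>lborel)"
proof -
  \<comment> \<open>A value \<open>c\<close> is the length of the set of positive levels below it;
    Tonelli then swaps the integrals. The indicator discards negative levels, which
    \<open>ennreal\<close> would send to 0.\<close>
  have inner: "(\<integral>\<^sup>+r. indicator {0<..} r * (if ennreal r < c then 1 else 0) \<partial>lborel) = c" for c :: ennreal
  proof (cases c)
    case (real b)
    have "(\<integral>\<^sup>+r. indicator {0<..} r * (if ennreal r < c then 1 else 0) \<partial>lborel)
        = (\<integral>\<^sup>+r. indicator {0<..<b} r \<partial>lborel)"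
      using real by (intro nn_integral_cong) (auto simp: indicator_def ennreal_less_iff)
    then show ?thesis using real by simp
  next
    case top
    have "(\<integral>\<^sup>+r. indicator {0<..} r * (if ennreal r < c then 1 else 0) \<partial>lborel)
        = (\<integral>\<^sup>+r. indicator {0::real<..} r \<partial>lborel)"
      using top by (intro nn_integral_cong) (auto simp: indicator_def)
    also have "\<dots> = emeasure lborel {0::real<..}" by simp
    also have "\<dots> = top"
    proof -
      have "(SUP n. of_nat n) \<le> emeasure lborel {0::real<..}"
      proof (rule SUP_least)
        fix n :: nat
        have "of_nat n = emeasure lborel {0<..<real n}"
          by (simp add: ennreal_of_nat_eq_real_of_nat)
        also have "\<dots> \<le> emeasure lborel {0::real<..}"
          by (intro emeasure_mono) auto
        finally show "of_nat n \<le> emeasure lborel {0::real<..}" .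
      qed
      then show "emeasure lborel {0::real<..} = top"
        by (simp add: ennreal_SUP_of_nat_eq_top top_unique)
    qed
    finally show ?thesis using top by simp
  qed
  have "(\<integral>\<^sup>+x. f x \<partial>lborel)
      = (\<integral>\<^sup>+x. (\<integral>\<^sup>+r. indicator {0<..} r * (if ennreal r < f x then 1 else 0) \<partial>lborel) \<partial>lborel)"
    by (simp add: inner)
  also have "\<dots> = (\<integral>\<^sup>+r. (\<integral>\<^sup>+x. indicator {0<..} r * (if ennreal r < f x then 1 else 0) \<partial>lborel) \<partial>lborel)"
    by (rule lborel_pair.Fubini') measurable
  also have "\<dots> = (\<integral>\<^sup>+r. indicator {0<..} r * emeasure lborel {x. ennreal r < f x} \<partial>lborel)"
  proof (intro nn_integral_cong)
    fix r :: real
    have "(\<integral>\<^sup>+x. indicator {0<..} r * (if ennreal r < f x then 1 else 0) \<partial>lborel)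
        = (\<integral>\<^sup>+x. indicator {0<..} r * indicator {x. ennreal r < f x} x \<partial>lborel)"
      by (intro nn_integral_cong) (auto simp: indicator_def)
    also have "\<dots> = indicator {0<..} r * emeasure lborel {x. ennreal r < f x}"
      by (subst nn_integral_cmult) auto
    finally show "(\<integral>\<^sup>+x. indicator {0<..} r * (if ennreal r < f x then 1 else 0) \<partial>lborel) = \<dots>" .
  qed
  finally show ?thesis .
qed

text \<open>Since both suprema are 1, the superlevel sets of \<open>f\<close> and \<open>g\<close> are nonempty at the same levels, so
  the layer cake formula and the one-dimensional Brunn-Minkowski inequality bound even the sum.\<close>

lemma prekopa_leindler_normalized:
  fixes f g h :: "real \<Rightarrow> ennreal"
  assumes f[measurable]: "f \<in> borel_measurable borel" and g[measurable]: "g \<in> borel_measurable borel"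
    and h[measurable]: "h \<in> borel_measurable borel"
    and suppf: "bounded {x. f x \<noteq> 0}" and suppg: "bounded {x. g x \<noteq> 0}"
    and sup: "(SUP x. f x) = 1" "(SUP x. g x) = 1"
    and le: "\<And>x y. f x * g y \<le> (h (x + y))\<^sup>2"
  shows "(\<integral>\<^sup>+x. f x \<partial>lborel) + (\<integral>\<^sup>+x. g x \<partial>lborel) \<le> (\<integral>\<^sup>+x. h x \<partial>lborel)"
proof -
  have "indicator {0<..} r * emeasure lborel {x. ennreal r < f x}
      + indicator {0<..} r * emeasure lborel {x. ennreal r < g x}
    \<le> indicator {0<..} r * emeasure lborel {x. ennreal r < h x}" for r :: real
  proof (cases "0 < r")
    case r: True
    have *: "emeasure lborel {x. ennreal r < f x} + emeasure lborel {x. ennreal r < g x}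
        \<le> emeasure lborel {x. ennreal r < h x}"
    proof (cases "r < 1")
      case True
      then have r1: "ennreal r < 1" by (simp add: ennreal_less_one_iff)
      show ?thesis
      proof (rule sumset_measure)
        show "{x. ennreal r < f x} \<in> sets borel" "{x. ennreal r < g x} \<in> sets borel"
            "{x. ennreal r < h x} \<in> sets borel"
          by measurable
        show "bounded {x. ennreal r < f x}" "bounded {x. ennreal r < g x}"
          by (rule bounded_subset[OF suppf], force) (rule bounded_subset[OF suppg], force)
        show "{x. ennreal r < f x} \<noteq> {}" "{x. ennreal r < g x} \<noteq> {}"
          using r1 less_SUP_iff[of "ennreal r" f UNIV] less_SUP_iff[of "ennreal r" g UNIV] by (auto simp: sup)
        fix x y assume xy: "x \<in> {x. ennreal r < f x}" "y \<in> {x. ennreal r < g x}"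
        show "x + y \<in> {x. ennreal r < h x}"
        proof (rule ccontr)
          assume "x + y \<notin> {x. ennreal r < h x}"
          then have "(h (x + y))\<^sup>2 \<le> ennreal r * ennreal r"
            by (auto simp: power2_eq_square not_less intro: mult_mono)
          \<comment> \<open>Only the factor \<open>g y\<close> is enlarged strictly: multiplication
            by the positive and finite \<open>ennreal r\<close> preserves strictness.\<close>
          also have "\<dots> < ennreal r * g y"
            using xy r by (intro ennreal_mult_strict_left_mono) auto
          also have "\<dots> \<le> f x * g y"
            using xy by (intro mult_right_mono) auto
          finally show False using le[of x y] by simp
        qed
      qed
    next
      case False
      then have r1: "1 \<le> ennreal r" by (simp add: not_less)
      have fg1: "f x \<le> 1" "g x \<le> 1" for x
        using SUP_upper[of x UNIV f] SUP_upper[of x UNIV g] by (simp_all add: sup)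
      have "f x \<le> ennreal r" "g x \<le> ennreal r" for x
        using order_trans[OF fg1(1) r1] order_trans[OF fg1(2) r1] by auto
      then have "{x. ennreal r < f x} = {}" "{x. ennreal r < g x} = {}"
        by (simp_all add: not_less)
      then show ?thesis by simp
    qed
    then show ?thesis using r by simp
  qed simp
  then have "(\<integral>\<^sup>+r. indicator {0<..} r * emeasure lborel {x. ennreal r < f x}
      + indicator {0<..} r * emeasure lborel {x. ennreal r < g x} \<partial>lborel)
    \<le> (\<integral>\<^sup>+r. indicator {0<..} r * emeasure lborel {x. ennreal r < h x} \<partial>lborel)"
    by (intro nn_integral_mono)
  then show ?thesis
    by (subst (asm) nn_integral_add) (simp_all only: nn_integral_layer_cake[OF f] nn_integral_layer_cake[OF g]
      nn_integral_layer_cake[OF h], measurable)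
qed

text \<open>The elementary bound 4xy <= (x + y)^2 converts the additive conclusion of the normalized
  case into a product. The factor 4 belongs to evaluating \<open>h\<close> at \<open>x + y\<close>
  instead of at the midpoint.\<close>

lemma four_mult_le_square:
  fixes x y z :: ennreal
  assumes "x + y \<le> z"
  shows "4 * (x * y) \<le> z\<^sup>2"
proof -
  have "4 * (x * y) \<le> (x + y)\<^sup>2"
  proof (cases "x = top \<or> y = top")
    case True
    then show ?thesis by (auto simp: power2_eq_square)
  next
    case False
    then obtain a b where ab: "x = ennreal a" "y = ennreal b" "a \<ge> 0" "b \<ge> 0"
      by (metis ennreal_cases)
    have "4 * (a * b) \<le> (a + b)\<^sup>2"
      using sum_squares_bound[of a b] by (simp add: power2_eq_square algebra_simps)
    then have "ennreal (4 * (a * b)) \<le> ennreal ((a + b)\<^sup>2)"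
      by (rule ennreal_leI)
    then show ?thesis
      using ab by (simp add: ennreal_mult ennreal_power[symmetric])
  qed
  also have "\<dots> \<le> z\<^sup>2" using assms by (intro power_mono) auto
  finally show ?thesis .
qed

text \<open>The hypothesis is homogeneous, so dividing \<open>f\<close> and \<open>g\<close> by
  their suprema, and \<open>h\<close> by the geometric mean of these suprema, leads to the
  normalized case. The bound \<open>n\<close> keeps the suprema finite.\<close>

lemma prekopa_leindler_bounded:
  fixes f g h :: "real \<Rightarrow> ennreal"
  assumes f[measurable]: "f \<in> borel_measurable borel" and g[measurable]: "g \<in> borel_measurable borel"
    and h[measurable]: "h \<in> borel_measurable borel"
    and suppf: "bounded {x. f x \<noteq> 0}" and suppg: "bounded {x. g x \<noteq> 0}"
    and bd: "\<And>x. f x \<le> of_nat n" "\<And>x. g x \<le> of_nat n"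
    and le: "\<And>x y. f x * g y \<le> (h (x + y))\<^sup>2"
  shows "4 * ((\<integral>\<^sup>+x. f x \<partial>lborel) * (\<integral>\<^sup>+x. g x \<partial>lborel)) \<le> (\<integral>\<^sup>+x. h x \<partial>lborel)\<^sup>2"
proof -
  define a b where "a = (SUP x. f x)" and "b = (SUP x. g x)"
  have "a \<le> of_nat n" "b \<le> of_nat n"
    unfolding a_def b_def by (auto intro!: SUP_least bd)
  then have fin: "a < top" "b < top"
    by (auto intro: le_less_trans[OF _ of_nat_less_top])
  show ?thesis
  proof (cases "a = 0 \<or> b = 0")
    case True
    then have "(\<forall>x. f x = 0) \<or> (\<forall>x. g x = 0)"
      unfolding a_def b_def by (auto simp: SUP_eq_iff bot_ennreal[symmetric] SUP_bot_conv)
    then show ?thesis by auto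
  next
    case False
    from fin obtain a' b' where ab': "a = ennreal a'" "b = ennreal b'" "a' \<ge> 0" "b' \<ge> 0"
      by (metis ennreal_cases less_irrefl)
    with False have pos: "a' > 0" "b' > 0"
      by (auto simp: order.strict_iff_order)
    define c where "c = ennreal (sqrt (a' * b'))"
    have c2: "c * c = a * b"
      using ab' by (simp add: c_def flip: ennreal_mult)
    have c: "c \<noteq> 0" "c \<noteq> top"
      using pos by (auto simp: c_def)
    have ab: "a \<noteq> 0" "a \<noteq> top" "b \<noteq> 0" "b \<noteq> top" using False fin by auto
    have inv: "inverse a * inverse b = inverse (a * b)"
      using fin by (simp add: ennreal_inverse_mult)
    have inv': "inverse c * inverse c = inverse (a * b)"
      using c by (simp add: ennreal_inverse_mult less_top flip: c2)
    have div: "u / a * (v / b) = u * v / (a * b)" "w / c * (w / c) = w * w / (a * b)" for u v w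
      unfolding divide_ennreal_def
      by (simp add: inv[symmetric] ac_simps, simp add: inv'[symmetric] ac_simps)
    have "(\<integral>\<^sup>+x. f x / a \<partial>lborel) + (\<integral>\<^sup>+x. g x / b \<partial>lborel) \<le> (\<integral>\<^sup>+x. h x / c \<partial>lborel)"
    proof (rule prekopa_leindler_normalized)
      show "bounded {x. f x / a \<noteq> 0}" "bounded {x. g x / b \<noteq> 0}"
        by (rule bounded_subset[OF suppf], force) (rule bounded_subset[OF suppg], force)
      show "(SUP x. f x / a) = 1" "(SUP x. g x / b) = 1"
        using ab by (simp_all add: SUP_divide_ennreal[symmetric] a_def[symmetric] b_def[symmetric] ennreal_divide_self less_top)
      fix x y
      have "f x * g y / (a * b) \<le> h (x + y) * h (x + y) / (a * b)"
        using le[of x y] by (simp add: divide_right_mono_ennreal power2_eq_square)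
      then show "f x / a * (g y / b) \<le> (h (x + y) / c)\<^sup>2"
        by (simp add: div power2_eq_square)
    qed measurable
    then have "4 * ((\<integral>\<^sup>+x. f x \<partial>lborel) / a * ((\<integral>\<^sup>+x. g x \<partial>lborel) / b)) \<le> ((\<integral>\<^sup>+x. h x \<partial>lborel) / c)\<^sup>2"
      by (intro four_mult_le_square) (simp add: nn_integral_divide)
    then have "4 * ((\<integral>\<^sup>+x. f x \<partial>lborel) * (\<integral>\<^sup>+x. g x \<partial>lborel) / (a * b))
        \<le> (\<integral>\<^sup>+x. h x \<partial>lborel) * (\<integral>\<^sup>+x. h x \<partial>lborel) / (a * b)"
      by (simp only: div power2_eq_square)
    then have "4 * ((\<integral>\<^sup>+x. f x \<partial>lborel) * (\<integral>\<^sup>+x. g x \<partial>lborel) / (a * b)) * (a * b)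
        \<le> (\<integral>\<^sup>+x. h x \<partial>lborel) * (\<integral>\<^sup>+x. h x \<partial>lborel) / (a * b) * (a * b)"
      by (rule mult_right_mono) simp
    moreover have "a * b \<noteq> 0" "a * b < top"
      using ab fin by (simp_all add: ennreal_mult_less_top)
    then have "u / (a * b) * (a * b) = u" for u
      by (subst ennreal_divide_times, subst ennreal_divide_self) simp_all
    ultimately show ?thesis
      by (simp only: mult.assoc[of 4] power2_eq_square)
  qed
qed

text \<open>Truncating \<open>f\<close> and \<open>g\<close> in height and support, with
  \<open>h\<close> kept fixed, gives the bounded case; monotone convergence removes the
  truncation.\<close>

lemma prekopa_leindler_real:
  fixes f g h :: "real \<Rightarrow> ennreal"
  assumes f[measurable]: "f \<in> borel_measurable borel" and g[measurable]: "g \<in> borel_measurable borel"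
    and h[measurable]: "h \<in> borel_measurable borel"
    and le: "\<And>x y. f x * g y \<le> (h (x + y))\<^sup>2"
  shows "4 * ((\<integral>\<^sup>+x. f x \<partial>lborel) * (\<integral>\<^sup>+x. g x \<partial>lborel)) \<le> (\<integral>\<^sup>+x. h x \<partial>lborel)\<^sup>2"
proof -
  define T where "T n p x = min (p x) (of_nat n) * indicator {- real n..real n} x"
    for n :: nat and p :: "real \<Rightarrow> ennreal" and x
  have T_le: "T n p x \<le> p x" "T n p x \<le> of_nat n" for n p x
    by (auto simp: T_def indicator_def)
  have mono: "incseq (\<lambda>n. T n p)" for p
    by (auto simp: incseq_def le_fun_def T_def indicator_def intro: min.coboundedI2)
  have meas[measurable]: "T n p \<in> borel_measurable borel" if [measurable]: "p \<in> borel_measurable borel" for n p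
    unfolding T_def by measurable
  have sup: "(SUP n. T n p x) = p x" for p x
  proof (rule antisym)
    show "(SUP n. T n p x) \<le> p x" by (auto intro: SUP_least T_le)
    obtain N :: nat where N: "\<bar>x\<bar> \<le> real N" using real_arch_simple by blast
    have "p x = (SUP n. min (p x) (of_nat n))"
      by (simp add: inf_min[symmetric] inf_SUP[symmetric] ennreal_SUP_of_nat_eq_top)
    also have "\<dots> \<le> (SUP n. T n p x)"
    proof (rule SUP_mono)
      fix n
      have "min (p x) (of_nat n) \<le> T (max n N) p x"
        using N by (auto simp: T_def indicator_def intro: min.coboundedI2)
      then show "\<exists>m\<in>UNIV. min (p x) (of_nat n) \<le> T m p x" by blast
    qed
    finally show "p x \<le> (SUP n. T n p x)" .
  qed
  have int_SUP: "(\<integral>\<^sup>+x. p x \<partial>lborel) = (SUP n. \<integral>\<^sup>+x. T n p x \<partial>lborel)"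
    if [measurable]: "p \<in> borel_measurable borel" for p
    using mono[of p] by (subst nn_integral_monotone_convergence_SUP[symmetric]) (auto simp: sup)
  have bsupp: "bounded {x. T n p x \<noteq> 0}" for n p
    by (rule bounded_subset[of "{- real n..real n}"]) (auto simp: T_def indicator_def)
  have bound: "4 * ((\<integral>\<^sup>+x. T n f x \<partial>lborel) * (\<integral>\<^sup>+x. T n g x \<partial>lborel)) \<le> (\<integral>\<^sup>+x. h x \<partial>lborel)\<^sup>2" for n
    by (rule prekopa_leindler_bounded[OF meas[OF f] meas[OF g] h bsupp bsupp T_le(2) T_le(2)])
      (rule order_trans[OF mult_mono[OF T_le(1) T_le(1)] le]; simp)
  \<comment> \<open>The product of two suprema is a supremum over independent indices; truncation at
    the larger index dominates both.\<close>
  have "4 * ((\<integral>\<^sup>+x. T n f x \<partial>lborel) * (\<integral>\<^sup>+x. T m g x \<partial>lborel)) \<le> (\<integral>\<^sup>+x. h x \<partial>lborel)\<^sup>2" for n m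
  proof -
    have "T n p x \<le> T (max n m) p x" "T m p x \<le> T (max n m) p x" for p x
      using mono[of p] by (auto simp: incseq_def le_fun_def)
    then have "4 * ((\<integral>\<^sup>+x. T n f x \<partial>lborel) * (\<integral>\<^sup>+x. T m g x \<partial>lborel))
        \<le> 4 * ((\<integral>\<^sup>+x. T (max n m) f x \<partial>lborel) * (\<integral>\<^sup>+x. T (max n m) g x \<partial>lborel))"
      by (intro mult_left_mono mult_mono nn_integral_mono) auto
    then show ?thesis using bound[of "max n m"] by (rule order_trans)
  qed
  then show ?thesis
    by (simp add: int_SUP[OF f] int_SUP[OF g] SUP_mult_left_ennreal SUP_mult_right_ennreal SUP_le_iff)
qed

section \<open>The multiplicative form, through logarithmic coordinates\<close>

lemma nn_integral_exp_substitution: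
  fixes f :: "real \<Rightarrow> ennreal"
  assumes [measurable]: "f \<in> borel_measurable borel"
  shows "(\<integral>\<^sup>+u. f (exp u) * ennreal (exp u) \<partial>lborel) = (\<integral>\<^sup>+x. f x * indicator {0<..} x \<partial>lborel)"
proof -
  \<comment> \<open>The substitution is carried out on compact intervals that exhaust the line; the
    extra 1 keeps them nondegenerate already for \<open>n = 0\<close>.\<close>
  let ?l = "\<lambda>n x. f x * indicator {exp (- real n - 1)..exp (real n + 1)} x"
  let ?r = "\<lambda>n u. f (exp u) * ennreal (exp u) * indicator {- real n - 1..real n + 1} u"
  have eq: "(\<integral>\<^sup>+x. ?l n x \<partial>lborel) = (\<integral>\<^sup>+u. ?r n u \<partial>lborel)" for n
    by (rule nn_integral_substitution_aux) (auto intro!: derivative_eq_intros continuous_intros)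
  have inc: "incseq ?l" "incseq ?r"
  proof -
    have "?l m x \<le> ?l n x" "?r m x \<le> ?r n x" if "m \<le> n" for m n x
    proof -
      have "{exp (- real m - 1)..exp (real m + 1)} \<subseteq> {exp (- real n - 1)..exp (real n + 1)}"
          "{- real m - 1..real m + 1} \<subseteq> {- real n - 1..real n + 1}"
        using that by (simp_all add: atLeastatMost_subset_iff)
      then show "?l m x \<le> ?l n x" "?r m x \<le> ?r n x"
        by (auto intro!: mult_left_mono simp only: ennreal_indicator_less zero_le subsetD)
    qed
    then show "incseq ?l" "incseq ?r"
      by (auto simp only: incseq_def le_fun_def)
  qed
  have supl: "(SUP n. ?l n x) = f x * indicator {0<..} x" for x
  proof -
    have "(SUP n. indicator {exp (- real n - 1)..exp (real n + 1)} x) = (indicator {0<..} x :: ennreal)"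
    proof (cases "x > 0")
      case True
      obtain n :: nat where n: "\<bar>ln x\<bar> \<le> real n" using real_arch_simple by blast
      then have "exp (- real n - 1) \<le> x" "x \<le> exp (real n + 1)"
        using True by (auto simp: ln_ge_iff[symmetric] ln_le_cancel_iff[of x "exp (real n + 1)", symmetric] simp del: ln_le_cancel_iff)
      then have "1 = (indicator {exp (- real n - 1)..exp (real n + 1)} x :: ennreal)" by simp
      also have "\<dots> \<le> (SUP n. indicator {exp (- real n - 1)..exp (real n + 1)} x)" by (intro SUP_upper) simp
      finally show ?thesis
        using True by (auto intro!: antisym SUP_least simp: indicator_def)
    next
      case False
      then have "indicator {exp (- real n - 1)..exp (real n + 1)} x = (0::ennreal)" for n
        using less_le_trans[OF exp_gt_zero[of "- real n - 1"], of x] by (auto simp: indicator_def)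
      then show ?thesis using False by simp
    qed
    then show ?thesis by (simp flip: SUP_mult_left_ennreal)
  qed
  have supr: "(SUP n. ?r n u) = f (exp u) * ennreal (exp u)" for u
  proof -
    obtain n :: nat where n: "\<bar>u\<bar> \<le> real n" using real_arch_simple by blast
    then have "1 = (indicator {- real n - 1..real n + 1} u :: ennreal)" by (auto simp: indicator_def)
    also have "\<dots> \<le> (SUP n. indicator {- real n - 1..real n + 1} u)" by (intro SUP_upper) simp
    finally have "(SUP n. indicator {- real n - 1..real n + 1} u) = (1::ennreal)"
      by (auto intro!: antisym SUP_least simp: indicator_def)
    then show ?thesis by (simp flip: SUP_mult_left_ennreal)
  qed
  have "(\<integral>\<^sup>+x. f x * indicator {0<..} x \<partial>lborel) = (SUP n. \<integral>\<^sup>+x. ?l n x \<partial>lborel)"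
    using inc(1) by (subst nn_integral_monotone_convergence_SUP[symmetric]) (auto simp: supl)
  also have "\<dots> = (SUP n. \<integral>\<^sup>+u. ?r n u \<partial>lborel)"
    by (simp only: eq)
  also have "\<dots> = (\<integral>\<^sup>+u. f (exp u) * ennreal (exp u) \<partial>lborel)"
    using inc(2) by (subst nn_integral_monotone_convergence_SUP[symmetric]) (auto simp: supr)
  finally show ?thesis ..
qed

text \<open>With x = exp u and y = exp v products become sums, and the Jacobians fit the hypothesis
  because exp (u + v) is the square of exp ((u + v) / 2).\<close>

lemma prekopa_leindler_half_line:
  fixes f g h :: "real \<Rightarrow> ennreal"
  assumes [measurable]: "f \<in> borel_measurable borel" "g \<in> borel_measurable borel" "h \<in> borel_measurable borel"
    and le: "\<And>x y z. x > 0 \<Longrightarrow> y > 0 \<Longrightarrow> z > 0 \<Longrightarrow> z\<^sup>2 = x * y \<Longrightarrow> f x * g y \<le> (h z)\<^sup>2"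
  shows "(\<integral>\<^sup>+x. f x * indicator {0<..} x \<partial>lborel) * (\<integral>\<^sup>+x. g x * indicator {0<..} x \<partial>lborel)
    \<le> (\<integral>\<^sup>+x. h x * indicator {0<..} x \<partial>lborel)\<^sup>2"
proof -
  have "4 * ((\<integral>\<^sup>+u. f (exp u) * ennreal (exp u) \<partial>lborel) * (\<integral>\<^sup>+u. g (exp u) * ennreal (exp u) \<partial>lborel))
    \<le> (\<integral>\<^sup>+w. h (exp (w / 2)) * ennreal (exp (w / 2)) \<partial>lborel)\<^sup>2"
  proof (rule prekopa_leindler_real)
    fix u v :: real
    have "f (exp u) * ennreal (exp u) * (g (exp v) * ennreal (exp v))
        = f (exp u) * g (exp v) * ennreal (exp (u + v))"
      by (simp add: exp_add ennreal_mult ac_simps)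
    also have "\<dots> \<le> (h (exp ((u + v) / 2)))\<^sup>2 * ennreal (exp (u + v))"
      by (intro mult_right_mono le) (auto simp: power2_eq_square simp flip: exp_add)
    also have "ennreal (exp (u + v)) = (ennreal (exp ((u + v) / 2)))\<^sup>2"
      by (simp add: power2_eq_square flip: ennreal_mult exp_add)
    finally show "f (exp u) * ennreal (exp u) * (g (exp v) * ennreal (exp v))
        \<le> (h (exp ((u + v) / 2)) * ennreal (exp ((u + v) / 2)))\<^sup>2"
      by (simp add: power_mult_distrib)
  qed measurable
  also have "(\<integral>\<^sup>+w. h (exp (w / 2)) * ennreal (exp (w / 2)) \<partial>lborel)
      = 2 * (\<integral>\<^sup>+u. h (exp u) * ennreal (exp u) \<partial>lborel)"
    \<comment> \<open>Undoing the halving of \<open>w\<close> yields a factor 2, whose square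
      cancels the 4 of the additive form.\<close>
    by (subst nn_integral_real_affine[where c=2 and t=0]) auto
  finally have "4 * ((\<integral>\<^sup>+x. f x * indicator {0<..} x \<partial>lborel) * (\<integral>\<^sup>+x. g x * indicator {0<..} x \<partial>lborel))
      \<le> 4 * (\<integral>\<^sup>+x. h x * indicator {0<..} x \<partial>lborel)\<^sup>2"
    by (simp add: nn_integral_exp_substitution power_mult_distrib)
  then show ?thesis
    by (subst (asm) ennreal_mult_le_mult_iff) auto
qed

lemma nn_integral_split_sign:
  fixes p :: "real \<Rightarrow> ennreal"
  assumes [measurable]: "p \<in> borel_measurable borel"
  shows "(\<integral>\<^sup>+x. p x \<partial>lborel)
    = (\<integral>\<^sup>+x. p x * indicator {0<..} x \<partial>lborel) + (\<integral>\<^sup>+x. p (- x) * indicator {0<..} x \<partial>lborel)"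
proof -
  have "AE x in lborel. x \<noteq> (0::real)"
    by (rule AE_lborel_singleton)
  then have "(\<integral>\<^sup>+x. p x \<partial>lborel) = (\<integral>\<^sup>+x. p x * indicator {0<..} x + p x * indicator {..<0} x \<partial>lborel)"
    by (intro nn_integral_cong_AE) (auto simp: indicator_def elim!: eventually_mono)
  also have "\<dots> = (\<integral>\<^sup>+x. p x * indicator {0<..} x \<partial>lborel) + (\<integral>\<^sup>+x. p x * indicator {..<0} x \<partial>lborel)"
    by (intro nn_integral_add) auto
  also have "(\<integral>\<^sup>+x. p x * indicator {..<0} x \<partial>lborel)
      = ennreal \<bar>- 1\<bar> * (\<integral>\<^sup>+x. p (0 + - 1 * x) * indicator {..<0} (0 + - 1 * x) \<partial>lborel)"
    by (rule nn_integral_real_affine) auto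
  also have "\<dots> = (\<integral>\<^sup>+x. p (- x) * indicator {0<..} x \<partial>lborel)"
    by (simp add: indicator_def)
  finally show ?thesis .
qed

text \<open>Only the square of \<open>z\<close> is prescribed, so its sign is free: each product of
  a half-line integral of \<open>f\<close> with one of \<open>g\<close> is bounded by the square of
  the integral of \<open>h\<close> over either half-line.\<close>

lemma prekopa_leindler_geometric:
  fixes f g h :: "real \<Rightarrow> ennreal"
  assumes [measurable]: "f \<in> borel_measurable borel" "g \<in> borel_measurable borel" "h \<in> borel_measurable borel"
    and le: "\<And>x y z. z\<^sup>2 = \<bar>x * y\<bar> \<Longrightarrow> f x * g y \<le> (h z)\<^sup>2"
  shows "(\<integral>\<^sup>+x. f x \<partial>lborel) * (\<integral>\<^sup>+x. g x \<partial>lborel) \<le> (\<integral>\<^sup>+x. h x \<partial>lborel)\<^sup>2"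
proof -
  define I where "I p s = (\<integral>\<^sup>+x. p (s * x) * indicator {0<..} x \<partial>lborel)" for p :: "real \<Rightarrow> ennreal" and s :: real
  have split: "(\<integral>\<^sup>+x. p x \<partial>lborel) = I p 1 + I p (-1)" if "p \<in> borel_measurable borel" for p
    using nn_integral_split_sign[OF that] by (simp add: I_def)
  have quadrant: "I f s * I g t \<le> (I h r)\<^sup>2" if "\<bar>s\<bar> = 1" "\<bar>t\<bar> = 1" "\<bar>r\<bar> = 1" for r s t
    unfolding I_def
  proof (rule prekopa_leindler_half_line)
    fix x y z :: real assume xyz: "x > 0" "y > 0" "z > 0" "z\<^sup>2 = x * y"
    have "r\<^sup>2 = 1" using that(3) by (metis power2_abs power_one)
    then have "(r * z)\<^sup>2 = \<bar>(s * x) * (t * y)\<bar>"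
      using that(1,2) xyz by (simp add: abs_mult power_mult_distrib)
    then show "f (s * x) * g (t * y) \<le> (h (r * z))\<^sup>2" by (rule le)
  qed measurable
  \<comment> \<open>The smaller half of \<open>h\<close> bounds all four products, and four times
    the square of \<open>m\<close> is the square of \<open>m + m\<close>, so splitting by sign loses
    no constant.\<close>
  define m where "m = min (I h 1) (I h (-1))"
  have m: "I f s * I g t \<le> m\<^sup>2" if "\<bar>s\<bar> = 1" "\<bar>t\<bar> = 1" for s t
    using quadrant[OF that, of 1] quadrant[OF that, of "-1"] by (auto simp: m_def min_def)
  have "(I f 1 + I f (-1)) * (I g 1 + I g (-1))
      = I f 1 * I g 1 + I f 1 * I g (-1) + (I f (-1) * I g 1 + I f (-1) * I g (-1))"
    by (simp add: distrib_left distrib_right ac_simps)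
  also have "\<dots> \<le> m\<^sup>2 + m\<^sup>2 + (m\<^sup>2 + m\<^sup>2)"
    by (intro add_mono m) auto
  also have "\<dots> = (m + m)\<^sup>2"
    by (simp add: power2_eq_square distrib_left distrib_right)
  also have "\<dots> \<le> (I h 1 + I h (-1))\<^sup>2"
    by (intro power_mono add_mono) (auto simp: m_def)
  finally show ?thesis by (simp add: split)
qed

section \<open>Several dimensions, by induction on the coordinates\<close>

lemma prekopa_leindler_geometric_PiM:
  fixes f g h :: "('i \<Rightarrow> real) \<Rightarrow> ennreal"
  assumes "finite I"
    and "f \<in> borel_measurable (PiM I (\<lambda>_. lborel))" "g \<in> borel_measurable (PiM I (\<lambda>_. lborel))"
      "h \<in> borel_measurable (PiM I (\<lambda>_. lborel))"
    and "\<And>x y z. (\<forall>i\<in>I. (z i)\<^sup>2 = \<bar>x i * y i\<bar>) \<Longrightarrow> f x * g y \<le> (h z)\<^sup>2"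
  shows "(\<integral>\<^sup>+x. f x \<partial>PiM I (\<lambda>_. lborel)) * (\<integral>\<^sup>+x. g x \<partial>PiM I (\<lambda>_. lborel))
    \<le> (\<integral>\<^sup>+x. h x \<partial>PiM I (\<lambda>_. lborel))\<^sup>2"
  using assms
proof (induction I arbitrary: f g h rule: finite_induct)
  case empty
  interpret product_sigma_finite "\<lambda>_. lborel :: real measure" ..
  show ?case
    using empty.prems(4) by (simp add: nn_integral_empty)
next
  case (insert i I)
  interpret product_sigma_finite "\<lambda>_. lborel :: real measure" ..
  interpret fin: finite_product_sigma_finite "\<lambda>_. lborel :: real measure" I
    by standard fact
  note [measurable] = insert.prems(1,2,3)
  have slice: "(\<lambda>x. p (x(i := a))) \<in> borel_measurable (PiM I (\<lambda>_. lborel))"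
    if [measurable]: "p \<in> borel_measurable (PiM (insert i I) (\<lambda>_. lborel))" for p :: "('i \<Rightarrow> real) \<Rightarrow> ennreal" and a :: real
    using insert.hyps by measurable
  have marg: "(\<lambda>a. \<integral>\<^sup>+x. p (x(i := a)) \<partial>PiM I (\<lambda>_. lborel)) \<in> borel_measurable borel"
    if [measurable]: "p \<in> borel_measurable (PiM (insert i I) (\<lambda>_. lborel))" for p :: "('i \<Rightarrow> real) \<Rightarrow> ennreal"
    by measurable
  have "(\<integral>\<^sup>+a. (\<integral>\<^sup>+x. f (x(i := a)) \<partial>PiM I (\<lambda>_. lborel)) \<partial>lborel) * (\<integral>\<^sup>+a. (\<integral>\<^sup>+x. g (x(i := a)) \<partial>PiM I (\<lambda>_. lborel)) \<partial>lborel)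
    \<le> (\<integral>\<^sup>+a. (\<integral>\<^sup>+x. h (x(i := a)) \<partial>PiM I (\<lambda>_. lborel)) \<partial>lborel)\<^sup>2"
  \<comment> \<open>The marginals in coordinate \<open>i\<close> satisfy the one-dimensional
    hypothesis: this is the induction hypothesis for the slices at \<open>a\<close>,
    \<open>b\<close> and \<open>c\<close>.\<close>
  proof (rule prekopa_leindler_geometric[OF marg marg marg])
    fix a b c :: real
    assume c: "c\<^sup>2 = \<bar>a * b\<bar>"
    show "(\<integral>\<^sup>+x. f (x(i := a)) \<partial>PiM I (\<lambda>_. lborel)) * (\<integral>\<^sup>+x. g (x(i := b)) \<partial>PiM I (\<lambda>_. lborel))
      \<le> (\<integral>\<^sup>+x. h (x(i := c)) \<partial>PiM I (\<lambda>_. lborel))\<^sup>2"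
    proof (rule insert.IH[OF slice slice slice])
      fix x y z :: "'i \<Rightarrow> real"
      assume "\<forall>i\<in>I. (z i)\<^sup>2 = \<bar>x i * y i\<bar>"
      then show "f (x(i := a)) * g (y(i := b)) \<le> (h (z(i := c)))\<^sup>2"
        using c by (intro insert.prems(4)) auto
    qed fact+
  qed fact+
  then show ?case
    using insert.hyps by (simp add: product_nn_integral_insert_rev)
qed

proposition prekopa_leindler_geometric_euclidean:
  fixes f g h :: "'a::euclidean_space \<Rightarrow> ennreal"
  assumes [measurable]: "f \<in> borel_measurable borel" "g \<in> borel_measurable borel" "h \<in> borel_measurable borel"
    and le: "\<And>x y z. (\<forall>b\<in>Basis. (z \<bullet> b)\<^sup>2 = \<bar>(x \<bullet> b) * (y \<bullet> b)\<bar>) \<Longrightarrow> f x * g y \<le> (h z)\<^sup>2"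
  shows "(\<integral>\<^sup>+x. f x \<partial>lborel) * (\<integral>\<^sup>+x. g x \<partial>lborel) \<le> (\<integral>\<^sup>+x. h x \<partial>lborel)\<^sup>2"
proof -
  let ?v = "\<lambda>x::'a \<Rightarrow> real. \<Sum>b\<in>Basis. x b *\<^sub>R b"
  have eq: "(\<integral>\<^sup>+x. p x \<partial>lborel) = (\<integral>\<^sup>+x. p (?v x) \<partial>PiM Basis (\<lambda>_. lborel))"
    if [measurable]: "p \<in> borel_measurable borel" for p :: "'a \<Rightarrow> ennreal"
    by (subst lborel_eq) (simp add: nn_integral_distr)
  have "(\<integral>\<^sup>+x. f (?v x) \<partial>PiM Basis (\<lambda>_. lborel)) * (\<integral>\<^sup>+x. g (?v x) \<partial>PiM Basis (\<lambda>_. lborel))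
    \<le> (\<integral>\<^sup>+x. h (?v x) \<partial>PiM Basis (\<lambda>_. lborel))\<^sup>2"
  proof (rule prekopa_leindler_geometric_PiM)
    fix x y z :: "'a \<Rightarrow> real"
    assume "\<forall>b\<in>Basis. (z b)\<^sup>2 = \<bar>x b * y b\<bar>"
    then show "f (?v x) * g (?v y) \<le> (h (?v z))\<^sup>2"
      by (intro le) (simp add: inner_sum_left_Basis)
  qed (simp, measurable)
  then show ?thesis
    by (simp only: eq[OF assms(1)] eq[OF assms(2)] eq[OF assms(3)])
qed

section \<open>Gaussian integrals over the ball\<close>

text \<open>The argument \<open>t\<close> holds reciprocal variances. The Gaussian normalising
  factors are left out, as they cancel in the quotient of \<open>alpha_k\<close> by
  \<open>alpha\<close>.\<close>

definition weight :: "real ^ 'v \<Rightarrow> real ^ 'v \<Rightarrow> real" where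
  "weight t x = exp (- (\<Sum>k\<in>UNIV. t $ k * (x $ k)\<^sup>2) / 2)"

definition partition_fn :: "real \<Rightarrow> real ^ 'v \<Rightarrow> real" where
  "partition_fn \<rho> t = (LINT x:sq_ball \<rho>|lborel. weight t x)"

text \<open>Multiplied by -1/2 this is the partial derivative of the logarithm of
  \<open>partition_fn\<close> in \<open>t $ k\<close>, so it supplies the slopes of both tangent
  inequalities.\<close>

definition moment :: "real \<Rightarrow> 'v \<Rightarrow> real ^ 'v \<Rightarrow> real" where
  "moment \<rho> k t = (LINT x:sq_ball \<rho>|lborel. (x $ k)\<^sup>2 * weight t x) / partition_fn \<rho> t"

lemma weight_pos [simp]: "weight t x > 0"
  by (simp add: weight_def)

lemma weight_nonneg [simp]: "weight t x \<ge> 0"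
  by (simp add: weight_def)

lemma weight_le_one: "(\<And>k. t $ k \<ge> 0) \<Longrightarrow> weight t x \<le> 1"
  by (simp add: weight_def sum_nonneg)

lemma continuous_on_weight [continuous_intros]:
  "continuous_on S (\<lambda>x. weight t x)"
  unfolding weight_def by (intro continuous_intros) auto

lemma sq_ball_eq_cball: "\<rho> > 0 \<Longrightarrow> sq_ball \<rho> = cball 0 (sqrt \<rho>)"
  by (auto simp: sq_ball_def norm_eq_sqrt_inner)

lemma compact_sq_ball: "\<rho> > 0 \<Longrightarrow> compact (sq_ball \<rho>)"
  by (simp add: sq_ball_eq_cball)

lemma sq_ball_integrable:
  fixes f :: "real ^ 'v \<Rightarrow> real"
  assumes "\<rho> > 0" "continuous_on UNIV f"
  shows "set_integrable lborel (sq_ball \<rho>) f"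
  unfolding set_integrable_def
  using borel_integrable_compact[OF compact_sq_ball[OF assms(1)], of f] continuous_on_subset[OF assms(2)]
  by auto

text \<open>A vanishing integral would force \<open>f\<close> to be zero almost everywhere on the
  ball, but by continuity \<open>f\<close> is nonzero on an open set around \<open>x0\<close>, which
  cannot be null. Taking \<open>x0\<close> in the open ball keeps that set inside.\<close>

lemma sq_ball_integral_pos:
  fixes f :: "real ^ 'v \<Rightarrow> real"
  assumes \<rho>: "\<rho> > 0" and cont: "continuous_on UNIV f" and nonneg: "\<And>x. f x \<ge> 0"
    and x0: "norm x0 < sqrt \<rho>" "f x0 \<noteq> 0"
  shows "(LINT x:sq_ball \<rho>|lborel. f x) > 0"
proof -
  let ?F = "\<lambda>x. indicator (sq_ball \<rho>) x *\<^sub>R f x"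
  have int: "integrable lborel ?F"
    using sq_ball_integrable[OF \<rho> cont] by (simp add: set_integrable_def)
  have nn: "AE x in lborel. 0 \<le> ?F x" using nonneg by simp
  have "integral\<^sup>L lborel ?F \<ge> 0"
    using nonneg by (intro integral_nonneg_AE) auto
  moreover have "integral\<^sup>L lborel ?F \<noteq> 0"
  proof
    assume "integral\<^sup>L lborel ?F = 0"
    then have ae: "AE x in lborel. ?F x = 0"
      using integral_nonneg_eq_0_iff_AE[OF int nn] by simp
    define U where "U = ball 0 (sqrt \<rho>) \<inter> {x. f x \<noteq> 0}"
    have "open U"
      unfolding U_def using open_Collect_neq[OF cont continuous_on_const[of UNIV 0]] by (intro open_Int) auto
    have U0: "x0 \<in> U" using x0 by (simp add: U_def)
    have "AE x in lborel. x \<notin> U"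
      using ae by eventually_elim (auto simp: U_def sq_ball_eq_cball[OF \<rho>])
    then have "U \<in> null_sets lborel"
      using \<open>open U\<close> by (subst AE_iff_null_sets) auto
    then have "negligible U"
      by (simp add: negligible_iff_null_sets null_sets_completionI)
    then show False
      using open_not_negligible[OF \<open>open U\<close>] U0 by auto
  qed
  ultimately show ?thesis by (simp add: set_lebesgue_integral_def)
qed

lemma partition_fn_pos: "\<rho> > 0 \<Longrightarrow> partition_fn \<rho> t > 0"
  unfolding partition_fn_def
  by (rule sq_ball_integral_pos[of _ _ 0]) (auto intro: continuous_intros simp: less_imp_neq[symmetric])

lemma moment_pos:
  fixes t :: "real ^ 'v"
  assumes \<rho>: "\<rho> > 0"
  shows "moment \<rho> k t > 0"
proof -
  \<comment> \<open>Half the radius along axis \<open>k\<close>: an interior point whose coordinate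
    \<open>k\<close> is nonzero.\<close>
  let ?x = "axis k (sqrt \<rho> / 2) :: real ^ 'v"
  have "(LINT x:sq_ball \<rho>|lborel. (x $ k)\<^sup>2 * weight t x) > 0"
  proof (rule sq_ball_integral_pos[OF \<rho>])
    show "norm ?x < sqrt \<rho>" using \<rho> by (simp add: norm_eq_sqrt_inner inner_axis_axis)
    show "(?x $ k)\<^sup>2 * weight t ?x \<noteq> 0"
      using \<rho> weight_pos[of t ?x] by (simp add: less_imp_neq[symmetric])
  qed (auto intro!: continuous_intros)
  then show ?thesis
    using partition_fn_pos[OF \<rho>, of t] unfolding moment_def by (rule divide_pos_pos)
qed

section \<open>Strict convexity of the log partition function\<close>

lemma integral_quadratic_weight:
  fixes t c :: "real ^ 'v"
  assumes \<rho>: "\<rho> > 0"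
  shows "(LINT x:sq_ball \<rho>|lborel. (\<Sum>k\<in>UNIV. c $ k * (x $ k)\<^sup>2) * weight t x)
    = partition_fn \<rho> t * (\<Sum>k\<in>UNIV. c $ k * moment \<rho> k t)"
proof -
  have int: "set_integrable lborel (sq_ball \<rho>) (\<lambda>x. c $ k * ((x $ k)\<^sup>2 * weight t x))" for k
    by (rule sq_ball_integrable[OF \<rho>]) (intro continuous_intros)
  have "(LINT x:sq_ball \<rho>|lborel. (\<Sum>k\<in>UNIV. c $ k * (x $ k)\<^sup>2) * weight t x)
      = (LINT x:sq_ball \<rho>|lborel. (\<Sum>k\<in>UNIV. c $ k * ((x $ k)\<^sup>2 * weight t x)))"
    by (simp add: sum_distrib_right mult.assoc)
  also have "\<dots> = (\<Sum>k\<in>UNIV. LINT x:sq_ball \<rho>|lborel. c $ k * ((x $ k)\<^sup>2 * weight t x))"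
    using int unfolding set_lebesgue_integral_def set_integrable_def scaleR_sum_right
    by (intro Bochner_Integration.integral_sum)
  also have "\<dots> = partition_fn \<rho> t * (\<Sum>k\<in>UNIV. c $ k * moment \<rho> k t)"
    using partition_fn_pos[OF \<rho>, of t] by (simp add: moment_def sum_distrib_left)
  finally show ?thesis .
qed

text \<open>Passing from \<open>t\<close> to \<open>s\<close> multiplies the weight by exp (- q).
  Integrate exp (m - q) >= 1 + (m - q) against \<open>weight t\<close>: as \<open>m\<close> is the
  mean of \<open>q\<close>, the linear term drops out. Strictness holds because \<open>q\<close> is
  not identically \<open>m\<close> in the ball.\<close>

lemma gibbs_strict:
  fixes s t :: "real ^ 'v"
  assumes \<rho>: "\<rho> > 0" and ne: "s \<noteq> t"
  shows "ln (partition_fn \<rho> t) - (\<Sum>k\<in>UNIV. (s $ k - t $ k) * moment \<rho> k t) / 2 < ln (partition_fn \<rho> s)"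
proof -
  define q where "q x = (\<Sum>k\<in>UNIV. (s - t) $ k * (x $ k)\<^sup>2) / 2" for x :: "real ^ 'v"
  define m where "m = (\<Sum>k\<in>UNIV. (s - t) $ k * moment \<rho> k t) / 2"
  have contq: "continuous_on UNIV q"
    unfolding q_def by (intro continuous_intros) auto
  have ws: "weight s x = weight t x * exp (- q x)" for x
    by (simp add: weight_def q_def algebra_simps sum_subtractf diff_divide_distrib add_divide_distrib flip: exp_add)
  have iq: "(LINT x:sq_ball \<rho>|lborel. q x * weight t x) = partition_fn \<rho> t * m"
    using integral_quadratic_weight[OF \<rho>, of "s - t" t] unfolding q_def m_def by simp
  have int: "set_integrable lborel (sq_ball \<rho>) (\<lambda>x. weight s x)"
      "set_integrable lborel (sq_ball \<rho>) (\<lambda>x. weight t x)"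
      "set_integrable lborel (sq_ball \<rho>) (\<lambda>x. q x * weight t x)"
    by (rule sq_ball_integrable[OF \<rho>]; intro continuous_intros contq)+
  let ?f = "\<lambda>x. weight t x * (exp (m - q x) - (1 + (m - q x)))"
  have strict: "exp u \<noteq> 1 + u" if "u \<noteq> 0" for u :: real
    using exp_minus_greater[of "-u"] that by auto
  \<comment> \<open>\<open>q\<close> vanishes at the origin, which therefore serves unless
    \<open>m = 0\<close>; in that case a point on an axis where \<open>s\<close> and
    \<open>t\<close> differ gives a nonzero value.\<close>
  obtain x0 where x0: "norm x0 < sqrt \<rho>" "q x0 \<noteq> m"
  proof (cases "m = 0")
    case False
    then show ?thesis using \<rho> by (intro that[of 0]) (auto simp: q_def)
  next
    case True
    obtain k where k: "s $ k \<noteq> t $ k" using ne by (auto simp: vec_eq_iff)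
    let ?x = "axis k (sqrt \<rho> / 2) :: real ^ 'v"
    have "(\<Sum>i\<in>UNIV. (s - t) $ i * (?x $ i)\<^sup>2) = (\<Sum>i\<in>UNIV. if i = k then (s $ k - t $ k) * (sqrt \<rho> / 2)\<^sup>2 else 0)"
      by (intro sum.cong) (auto simp: axis_def)
    then have "q ?x \<noteq> m" using k True \<rho> by (simp add: q_def)
    moreover have "norm ?x < sqrt \<rho>" using \<rho> by (simp add: norm_eq_sqrt_inner inner_axis_axis)
    ultimately show ?thesis using that by blast
  qed
  have "(LINT x:sq_ball \<rho>|lborel. ?f x) > 0"
  proof (rule sq_ball_integral_pos[OF \<rho> _ _ x0(1)])
    show "continuous_on UNIV ?f" by (intro continuous_intros contq)
    show "?f x \<ge> 0" for x
      using exp_ge_add_one_self[of "m - q x"] by simp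
    show "?f x0 \<noteq> 0"
      using strict[of "m - q x0"] x0(2) less_imp_neq[OF weight_pos[of t x0]] by auto
  qed
  also have "(LINT x:sq_ball \<rho>|lborel. ?f x)
    = (LINT x:sq_ball \<rho>|lborel. exp m * weight s x - ((1 + m) * weight t x - q x * weight t x))"
    by (simp add: ws exp_diff exp_minus algebra_simps divide_inverse)
  also have "\<dots> = exp m * partition_fn \<rho> s - ((1 + m) * partition_fn \<rho> t - partition_fn \<rho> t * m)"
    using int by (simp add: set_integral_diff set_integrable_mult_right partition_fn_def iq)
  finally have "partition_fn \<rho> t < exp m * partition_fn \<rho> s"
    by (simp add: algebra_simps)
  then have "ln (partition_fn \<rho> t) < ln (exp m * partition_fn \<rho> s)"
    using partition_fn_pos[OF \<rho>] by (subst ln_less_cancel_iff) auto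
  also have "\<dots> = m + ln (partition_fn \<rho> s)"
    using partition_fn_pos[OF \<rho>, of s] by (simp add: ln_mult_pos)
  finally show ?thesis by (simp add: m_def)
qed

lemma gibbs:
  fixes s t :: "real ^ 'v"
  assumes "\<rho> > 0"
  shows "ln (partition_fn \<rho> t) - (\<Sum>k\<in>UNIV. (s $ k - t $ k) * moment \<rho> k t) / 2 \<le> ln (partition_fn \<rho> s)"
  using gibbs_strict[OF assms, of s t] by (cases "s = t") auto

section \<open>Concavity in the logarithms of the parameters\<close>

lemma partition_fn_nn_integral:
  fixes t :: "real ^ 'v"
  assumes "\<rho> > 0"
  shows "(\<integral>\<^sup>+x. ennreal (indicator (sq_ball \<rho>) x * weight t x) \<partial>lborel) = ennreal (partition_fn \<rho> t)"
  using sq_ball_integrable[OF assms continuous_on_weight, of t]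
  by (simp add: nn_integral_eq_integral set_integrable_def partition_fn_def set_lebesgue_integral_def)

text \<open>In logarithmic parameters \<open>r\<close> is the midpoint of \<open>s\<close> and
  \<open>t\<close>, so this is midpoint concavity of the log partition function. By the
  arithmetic-geometric mean inequality, twice the quadratic form of \<open>r\<close> at
  \<open>z\<close> is at most that of \<open>s\<close> at \<open>x\<close> plus that of
  \<open>t\<close> at \<open>y\<close>, as Prekopa-Leindler demands.\<close>

lemma partition_fn_geometric_mean:
  fixes s t r :: "real ^ 'v"
  assumes \<rho>: "\<rho> > 0" and pos: "\<And>k. s $ k > 0" "\<And>k. t $ k > 0" "\<And>k. r $ k > 0"
    and r: "\<And>k. (r $ k)\<^sup>2 = s $ k * t $ k"
  shows "partition_fn \<rho> s * partition_fn \<rho> t \<le> (partition_fn \<rho> r)\<^sup>2"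
proof -
  let ?F = "\<lambda>t x. ennreal (indicator (sq_ball \<rho>) x * weight t x)"
  have meas: "?F t \<in> borel_measurable borel" for t :: "real ^ 'v"
    using sq_ball_integrable[OF \<rho> continuous_on_weight, of t] by (auto simp: set_integrable_def dest: borel_measurable_integrable)
  have "(\<integral>\<^sup>+x. ?F s x \<partial>lborel) * (\<integral>\<^sup>+x. ?F t x \<partial>lborel) \<le> (\<integral>\<^sup>+x. ?F r x \<partial>lborel)\<^sup>2"
  proof (rule prekopa_leindler_geometric_euclidean[OF meas meas meas])
    fix x y z :: "real ^ 'v"
    assume "\<forall>b\<in>Basis. (z \<bullet> b)\<^sup>2 = \<bar>(x \<bullet> b) * (y \<bullet> b)\<bar>"
    then have z: "(z $ k)\<^sup>2 = \<bar>x $ k\<bar> * \<bar>y $ k\<bar>" for k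
      by (auto simp: Basis_vec_def inner_axis abs_mult)
    \<comment> \<open>Used twice: with all coefficients 1 it keeps \<open>z\<close> in the ball, and
      with the components of \<open>s\<close>, \<open>t\<close> and \<open>r\<close> it compares the
      weights.\<close>
    have amgm: "2 * (c * (z $ k)\<^sup>2) \<le> a * (x $ k)\<^sup>2 + b * (y $ k)\<^sup>2"
      if "a > 0" "b > 0" "c > 0" "c\<^sup>2 = a * b" for a b c k
    proof -
      have "c = sqrt a * sqrt b"
        using that by (metis real_sqrt_mult real_sqrt_unique less_imp_le)
      then have "2 * (c * (z $ k)\<^sup>2) = 2 * (sqrt a * \<bar>x $ k\<bar>) * (sqrt b * \<bar>y $ k\<bar>)"
        by (simp add: z)
      also have "\<dots> \<le> (sqrt a * \<bar>x $ k\<bar>)\<^sup>2 + (sqrt b * \<bar>y $ k\<bar>)\<^sup>2"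
        by (rule sum_squares_bound)
      finally show ?thesis using that by (simp add: power_mult_distrib)
    qed
    show "?F s x * ?F t y \<le> (?F r z)\<^sup>2"
    proof (cases "x \<in> sq_ball \<rho> \<and> y \<in> sq_ball \<rho>")
      case True
      have "2 * (z \<bullet> z) = (\<Sum>k\<in>UNIV. 2 * (1 * (z $ k)\<^sup>2))"
        by (simp add: inner_vec_def power2_eq_square sum_distrib_left)
      also have "\<dots> \<le> (\<Sum>k\<in>UNIV. 1 * (x $ k)\<^sup>2 + 1 * (y $ k)\<^sup>2)"
        by (intro sum_mono amgm) auto
      also have "\<dots> = x \<bullet> x + y \<bullet> y"
        by (simp add: inner_vec_def power2_eq_square sum.distrib)
      finally have zb: "z \<in> sq_ball \<rho>" using True by (simp add: sq_ball_def)
      have "2 * (\<Sum>k\<in>UNIV. r $ k * (z $ k)\<^sup>2) \<le> (\<Sum>k\<in>UNIV. s $ k * (x $ k)\<^sup>2) + (\<Sum>k\<in>UNIV. t $ k * (y $ k)\<^sup>2)"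
        unfolding sum_distrib_left sum.distrib[symmetric]
        by (intro sum_mono amgm pos r)
      then have "weight s x * weight t y \<le> weight r z * weight r z"
        unfolding weight_def exp_add[symmetric] by (subst exp_le_cancel_iff) simp
      then show ?thesis
        using True zb by (simp add: power2_eq_square ennreal_leI flip: ennreal_mult)
    qed auto
  qed
  then have "ennreal (partition_fn \<rho> s * partition_fn \<rho> t) \<le> ennreal ((partition_fn \<rho> r)\<^sup>2)"
    unfolding partition_fn_nn_integral[OF \<rho>]
    by (simp add: ennreal_mult less_imp_le[OF partition_fn_pos[OF \<rho>]] power2_eq_square)
  then show ?thesis
    by (subst (asm) ennreal_le_iff) auto
qed

section \<open>Continuity in the parameters\<close>

lemma sq_ball_weight_integral_tendsto:
  fixes t :: "nat \<Rightarrow> real ^ 'v"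
  assumes \<rho>: "\<rho> > 0" and nonneg: "\<And>n k. t n $ k \<ge> 0" and lim: "t \<longlonglongrightarrow> t'"
    and p: "continuous_on UNIV p"
  shows "(\<lambda>n. LINT x:sq_ball \<rho>|lborel. p x * weight (t n) x) \<longlonglongrightarrow> (LINT x:sq_ball \<rho>|lborel. p x * weight t' x)"
  unfolding set_lebesgue_integral_def
proof (rule integral_dominated_convergence)
  have "set_integrable lborel (sq_ball \<rho>) (\<lambda>x. p x * weight s x)" for s :: "real ^ 'v"
    by (rule sq_ball_integrable[OF \<rho>]) (intro continuous_intros p)
  then show "(\<lambda>x. indicator (sq_ball \<rho>) x *\<^sub>R (p x * weight t' x)) \<in> borel_measurable lborel"
      "\<And>n. (\<lambda>x. indicator (sq_ball \<rho>) x *\<^sub>R (p x * weight (t n) x)) \<in> borel_measurable lborel"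
    by (auto simp: set_integrable_def dest: borel_measurable_integrable)
  \<comment> \<open>Nonnegative parameters keep the weight at most 1, so the absolute value of
    \<open>p\<close> on the ball dominates every integrand.\<close>
  show "integrable lborel (\<lambda>x. indicator (sq_ball \<rho>) x *\<^sub>R \<bar>p x\<bar>)"
    using sq_ball_integrable[OF \<rho>, of "\<lambda>x. \<bar>p x\<bar>"] p by (simp add: set_integrable_def continuous_on_rabs)
  have "(\<lambda>n. weight (t n) x) \<longlonglongrightarrow> weight t' x" for x
    unfolding weight_def by (intro tendsto_intros tendsto_vec_nth[OF lim]) auto
  then show "AE x in lborel. (\<lambda>n. indicator (sq_ball \<rho>) x *\<^sub>R (p x * weight (t n) x))
      \<longlonglongrightarrow> indicator (sq_ball \<rho>) x *\<^sub>R (p x * weight t' x)"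
    by (intro AE_I2 tendsto_intros)
  show "AE x in lborel. norm (indicator (sq_ball \<rho>) x *\<^sub>R (p x * weight (t n) x)) \<le> indicator (sq_ball \<rho>) x *\<^sub>R \<bar>p x\<bar>" for n
    using weight_le_one[of "t n"] nonneg
    by (intro AE_I2) (auto simp: abs_mult indicator_def intro!: mult_left_le)
qed

lemma partition_fn_tendsto:
  fixes t :: "nat \<Rightarrow> real ^ 'v"
  assumes "\<rho> > 0" and "\<And>n k. t n $ k \<ge> 0" and "t \<longlonglongrightarrow> t'"
  shows "(\<lambda>n. partition_fn \<rho> (t n)) \<longlonglongrightarrow> partition_fn \<rho> t'"
  using sq_ball_weight_integral_tendsto[OF assms, of "\<lambda>_. 1"] by (simp add: partition_fn_def)

lemma moment_tendsto:
  fixes t :: "nat \<Rightarrow> real ^ 'v"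
  assumes "\<rho> > 0" and "\<And>n k. t n $ k \<ge> 0" and "t \<longlonglongrightarrow> t'"
  shows "(\<lambda>n. moment \<rho> k (t n)) \<longlonglongrightarrow> moment \<rho> k t'"
  unfolding moment_def
proof (rule tendsto_divide[OF sq_ball_weight_integral_tendsto[OF assms] partition_fn_tendsto[OF assms]])
  show "continuous_on UNIV (\<lambda>x::real ^ 'v. (x $ k)\<^sup>2)"
    by (intro continuous_intros)
  show "partition_fn \<rho> t' \<noteq> 0"
    using partition_fn_pos[OF assms(1), of t'] by simp
qed

section \<open>Convergence of the iteration\<close>

text \<open>Concavity in the logarithms is exploited without differentiating under the integral:
  repeated halving bounds the whole increment by a rescaled short one, \<open>gibbs\<close> bounds
  the short one, and these bounds converge to the slope at \<open>a\<close>.\<close>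

lemma log_partition_fn_tangent:
  fixes a t :: "real ^ 'v"
  assumes \<rho>: "\<rho> > 0" and a: "\<And>k. a $ k > 0" and t: "\<And>k. t $ k > 0"
  shows "ln (partition_fn \<rho> t)
    \<le> ln (partition_fn \<rho> a) - (\<Sum>k\<in>UNIV. a $ k * moment \<rho> k a * ln (t $ k / a $ k)) / 2"
proof -
  define d where "d k = ln (t $ k / a $ k)" for k
  \<comment> \<open>The straight line in logarithmic coordinates that passes through
    \<open>a\<close> at 0 and through \<open>t\<close> at 1.\<close>
  define c where "c u = (\<chi> k. a $ k * exp (u * d k))" for u :: real
  define \<phi> where "\<phi> u = ln (partition_fn \<rho> (c u))" for u
  have Zpos: "partition_fn \<rho> x > 0" for x :: "real ^ 'v"
    by (rule partition_fn_pos[OF \<rho>])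
  have cpos: "c u $ k > 0" for u k using a by (simp add: c_def)
  have c0: "c 0 = a" by (simp add: c_def)
  have c1: "c 1 = t"
    using a t by (simp add: c_def d_def vec_eq_iff less_imp_neq[symmetric])
  have mid: "\<phi> u + \<phi> 0 \<le> 2 * \<phi> (u / 2)" for u
  proof -
    have "partition_fn \<rho> (c u) * partition_fn \<rho> (c 0) \<le> (partition_fn \<rho> (c (u / 2)))\<^sup>2"
      by (rule partition_fn_geometric_mean[OF \<rho> cpos cpos cpos])
        (simp add: c_def power2_eq_square flip: exp_add)
    then have "ln (partition_fn \<rho> (c u) * partition_fn \<rho> (c 0)) \<le> ln ((partition_fn \<rho> (c (u / 2)))\<^sup>2)"
      by (subst ln_le_cancel_iff) (simp_all add: Zpos less_imp_neq[OF Zpos, symmetric])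
    then show ?thesis
      by (simp add: \<phi>_def ln_mult_pos ln_realpow Zpos)
  qed
  have iter: "\<phi> 1 - \<phi> 0 \<le> 2 ^ n * (\<phi> (1 / 2 ^ n) - \<phi> 0)" for n
  proof (induction n)
    case (Suc n)
    have "\<phi> (1 / 2 ^ n) - \<phi> 0 \<le> 2 * (\<phi> (1 / 2 ^ Suc n) - \<phi> 0)"
      using mid[of "1 / 2 ^ n"] by (simp add: mult.commute)
    then have "2 ^ n * (\<phi> (1 / 2 ^ n) - \<phi> 0) \<le> 2 ^ n * (2 * (\<phi> (1 / 2 ^ Suc n) - \<phi> 0))"
      by (rule mult_left_mono) simp
    also have "\<dots> = 2 ^ Suc n * (\<phi> (1 / 2 ^ Suc n) - \<phi> 0)" by simp
    finally show ?case by (rule order_trans[OF Suc.IH])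
  qed simp
  \<comment> \<open>The \<open>gibbs\<close> bound rescaled by \<open>2 ^ n\<close>; grouping the
    exponential as a difference quotient makes the limit of that factor \<open>d k\<close>.\<close>
  define X where "X n = - (\<Sum>k\<in>UNIV. a $ k * ((exp (1 / 2 ^ n * d k) - 1) / (1 / 2 ^ n)) * moment \<rho> k (c (1 / 2 ^ n))) / 2" for n :: nat
  have le: "\<phi> 1 - \<phi> 0 \<le> X n" for n
  proof -
    \<comment> \<open>The tangent is taken at the moving point and evaluated at \<open>a\<close>, so
      that convexity bounds the increment from above.\<close>
    have "\<phi> (1 / 2 ^ n) - \<phi> 0 \<le> (\<Sum>k\<in>UNIV. (a $ k - c (1 / 2 ^ n) $ k) * moment \<rho> k (c (1 / 2 ^ n))) / 2"
      using gibbs[OF \<rho>, of "c (1 / 2 ^ n)" a] by (simp add: \<phi>_def c0)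
    then have "2 ^ n * (\<phi> (1 / 2 ^ n) - \<phi> 0)
        \<le> 2 ^ n * ((\<Sum>k\<in>UNIV. (a $ k - c (1 / 2 ^ n) $ k) * moment \<rho> k (c (1 / 2 ^ n))) / 2)"
      by (intro mult_left_mono) auto
    also have "\<dots> = X n"
      by (simp add: X_def c_def sum_distrib_left sum_negf[symmetric] algebra_simps)
    finally show ?thesis using iter[of n] by simp
  qed
  have u0: "(\<lambda>n. 1 / 2 ^ n :: real) \<longlonglongrightarrow> 0"
    using LIMSEQ_power_zero[of "1/2 :: real"] by (simp add: power_one_over)
  then have u_at: "filterlim (\<lambda>n. 1 / 2 ^ n :: real) (at 0) sequentially"
    by (simp add: filterlim_at)
  have quot: "(\<lambda>n. (exp (1 / 2 ^ n * e) - 1) / (1 / 2 ^ n)) \<longlonglongrightarrow> e" for e :: real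
  proof -
    have "((\<lambda>u. exp (u * e)) has_real_derivative e) (at 0)"
      by (auto intro!: derivative_eq_intros)
    then have "((\<lambda>h. (exp (h * e) - 1) / h) \<longlongrightarrow> e) (at 0)"
      by (simp add: DERIV_def)
    from filterlim_compose[OF this u_at] show ?thesis .
  qed
  have clim: "(\<lambda>n. c (1 / 2 ^ n)) \<longlonglongrightarrow> a"
  proof -
    have "(\<lambda>n. a $ k * exp (1 / 2 ^ n * d k)) \<longlonglongrightarrow> a $ k * exp (0 * d k)" for k
      by (intro tendsto_intros u0)
    then show ?thesis by (intro vec_tendstoI) (simp add: c_def)
  qed
  have "X \<longlonglongrightarrow> - (\<Sum>k\<in>UNIV. a $ k * d k * moment \<rho> k a) / 2"
    unfolding X_def
    by (intro tendsto_intros quot moment_tendsto[OF \<rho> _ clim] less_imp_le cpos) auto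
  then have "\<phi> 1 - \<phi> 0 \<le> - (\<Sum>k\<in>UNIV. a $ k * d k * moment \<rho> k a) / 2"
    by (rule LIMSEQ_le_const) (use le in blast)
  then show ?thesis
    by (simp add: \<phi>_def c0 c1 d_def mult_ac)
qed

section \<open>The divergence and its decrease in one step\<close>

definition divergence :: "real \<Rightarrow> real ^ 'v \<Rightarrow> real ^ 'v \<Rightarrow> real" where
  "divergence \<rho> a t = (\<Sum>k\<in>UNIV. moment \<rho> k a * (a $ k * ln (a $ k / t $ k) - a $ k + t $ k))"

text \<open>The Bregman divergence of the log partition function based at \<open>a\<close>.\<close>

definition gap :: "real \<Rightarrow> real ^ 'v \<Rightarrow> real ^ 'v \<Rightarrow> real" where
  "gap \<rho> a t = ln (partition_fn \<rho> t) - ln (partition_fn \<rho> a) + (\<Sum>k\<in>UNIV. moment \<rho> k a * (t $ k - a $ k)) / 2"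

lemma gap_pos: "\<rho> > 0 \<Longrightarrow> t \<noteq> a \<Longrightarrow> gap \<rho> a t > 0"
  using gibbs_strict[of \<rho> t a] by (simp add: gap_def mult.commute)

lemma gap_nonneg: "\<rho> > 0 \<Longrightarrow> gap \<rho> a t \<ge> 0"
  using gibbs[of \<rho> a t] by (simp add: gap_def mult.commute)

lemma kl_term_nonneg:
  fixes a t :: real
  assumes "a > 0" "t > 0"
  shows "a * ln (a / t) - a + t \<ge> 0"
proof -
  have "ln (t / a) \<le> t / a - 1" using assms by (intro ln_le_minus_one) auto
  then have "a * ln (t / a) \<le> a * (t / a - 1)" using assms by (intro mult_left_mono) auto
  also have "\<dots> = t - a" using assms by (simp add: field_simps)
  finally show ?thesis using assms by (simp add: ln_div algebra_simps)
qed

text \<open>A bounded term keeps \<open>t\<close> away from infinity, because linear growth beats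
  the logarithm, and away from 0, because the logarithm blows up there.\<close>

lemma kl_term_bounds:
  fixes a t C :: real
  assumes a: "a > 0" and t: "t > 0" and C: "a * ln (a / t) - a + t \<le> C"
  shows "t \<le> 2 * (C + a)" "t \<ge> a * exp (- ((C + a) / a))"
proof -
  \<comment> \<open>Dividing by 2 first lets the logarithm absorb only half of \<open>t\<close>; the
    leftover constant ln 2 - 1 is negative.\<close>
  have "ln (t / a / 2) \<le> t / a / 2 - 1" using a t by (intro ln_le_minus_one) auto
  moreover have "ln (t / a / 2) = ln (t / a) - ln 2" using a t by (intro ln_divide_pos) auto
  ultimately have "ln (t / a) \<le> t / a / 2" using ln_2_less_1 by linarith
  then have "a * ln (t / a) \<le> a * (t / a / 2)" using a by (intro mult_left_mono) auto
  then have "a * ln (t / a) \<le> t / 2" using a by simp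
  moreover have "a * ln (a / t) = - (a * ln (t / a))" using a t by (simp add: ln_div algebra_simps)
  ultimately show "t \<le> 2 * (C + a)" using C by argo
  have "a * ln (a / t) \<le> C + a" using C t by linarith
  then have "ln (a / t) \<le> (C + a) / a" using a by (simp add: field_simps)
  moreover have "ln (t / a) = - ln (a / t)" using a t by (simp add: ln_div)
  ultimately have "- ((C + a) / a) \<le> ln (t / a)" by linarith
  then have "exp (- ((C + a) / a)) \<le> t / a" using a t by (simp add: ln_ge_iff)
  then show "t \<ge> a * exp (- ((C + a) / a))" using a by (simp add: field_simps)
qed

text \<open>The tangent of the log partition function at \<open>t\<close> bounds it from below, the logarithmic tangent at \<open>a\<close>
  from above; the point \<open>s\<close> in the proof minimises the difference of the two bounds.\<close>

lemma divergence_decrease: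
  fixes a t t' :: "real ^ 'v"
  assumes \<rho>: "\<rho> > 0" and a: "\<And>k. a $ k > 0" and t: "\<And>k. t $ k > 0"
    and t': "\<And>k. t' $ k = t $ k * moment \<rho> k t / moment \<rho> k a"
  shows "2 * gap \<rho> a t \<le> divergence \<rho> a t - divergence \<rho> a t'"
proof -
  have M: "moment \<rho> k x > 0" for k and x :: "real ^ 'v"
    by (rule moment_pos[OF \<rho>])
  define s where "s = (\<chi> k. a $ k * moment \<rho> k a / moment \<rho> k t)"
  define l where "l k = ln (moment \<rho> k t / moment \<rho> k a)" for k
  have s: "s $ k > 0" for k using a M[of k] by (simp add: s_def)
  have "ln (s $ k / a $ k) = - l k" for k
    using a[of k] M[of k a] M[of k t] by (simp add: s_def l_def ln_div)
  then have "ln (partition_fn \<rho> s)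
      \<le> ln (partition_fn \<rho> a) + (\<Sum>k\<in>UNIV. a $ k * moment \<rho> k a * l k) / 2"
    using log_partition_fn_tangent[OF \<rho> a s] by (simp add: sum_negf)
  moreover have "ln (partition_fn \<rho> t) - (\<Sum>k\<in>UNIV. a $ k * moment \<rho> k a - t $ k * moment \<rho> k t) / 2
      \<le> ln (partition_fn \<rho> s)"
  proof -
    have "(s $ k - t $ k) * moment \<rho> k t = a $ k * moment \<rho> k a - t $ k * moment \<rho> k t" for k
      using M[of k t] by (simp add: s_def left_diff_distrib)
    then show ?thesis using gibbs[OF \<rho>, of t s] by simp
  qed
  ultimately have "ln (partition_fn \<rho> t) - (\<Sum>k\<in>UNIV. a $ k * moment \<rho> k a - t $ k * moment \<rho> k t) / 2
      \<le> ln (partition_fn \<rho> a) + (\<Sum>k\<in>UNIV. a $ k * moment \<rho> k a * l k) / 2"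
    by (rule order_trans[rotated])
  then have "2 * gap \<rho> a t \<le> (\<Sum>k\<in>UNIV. a $ k * moment \<rho> k a * l k)
      + (\<Sum>k\<in>UNIV. a $ k * moment \<rho> k a - t $ k * moment \<rho> k t)
      + (\<Sum>k\<in>UNIV. moment \<rho> k a * (t $ k - a $ k))"
    unfolding gap_def by argo
  also have "\<dots> = divergence \<rho> a t - divergence \<rho> a t'"
    unfolding divergence_def sum.distrib[symmetric] sum_subtractf[symmetric]
  \<comment> \<open>The two bounds at \<open>s\<close> combine into exactly the change of the
    divergence, term by term: the update shifts each logarithm by \<open>l k\<close>.\<close>
  proof (rule sum.cong[OF refl])
    fix k
    have "ln (a $ k / t $ k) = ln (a $ k / t' $ k) + l k"
      using a[of k] t[of k] M[of k a] M[of k t] by (simp add: t' l_def ln_div ln_mult_pos)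
    moreover have "moment \<rho> k a * t' $ k = t $ k * moment \<rho> k t"
      using M[of k a] by (simp add: t')
    ultimately show "a $ k * moment \<rho> k a * l k + (a $ k * moment \<rho> k a - t $ k * moment \<rho> k t)
        + moment \<rho> k a * (t $ k - a $ k)
      = moment \<rho> k a * (a $ k * ln (a $ k / t $ k) - a $ k + t $ k)
        - moment \<rho> k a * (a $ k * ln (a $ k / t' $ k) - a $ k + t' $ k)"
      by (simp add: algebra_simps)
  qed
  finally show ?thesis .
qed

lemma divergence_nonneg:
  assumes "\<rho> > 0" and "\<And>k. a $ k > 0" and "\<And>k. t $ k > 0"
  shows "divergence \<rho> a t \<ge> 0"
  unfolding divergence_def
  by (intro sum_nonneg mult_nonneg_nonneg kl_term_nonneg less_imp_le[OF moment_pos] assms)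

lemma gap_tendsto:
  fixes t :: "nat \<Rightarrow> real ^ 'v"
  assumes "\<rho> > 0" and "\<And>n k. t n $ k \<ge> 0" and "t \<longlonglongrightarrow> t'"
  shows "(\<lambda>n. gap \<rho> a (t n)) \<longlonglongrightarrow> gap \<rho> a t'"
  unfolding gap_def
  using partition_fn_pos[OF assms(1), of t']
  by (intro tendsto_intros partition_fn_tendsto assms tendsto_vec_nth) auto

section \<open>The Lyapunov and compactness argument\<close>

proposition multiplicative_iteration_converges:
  fixes a :: "real ^ 'v" and T :: "nat \<Rightarrow> real ^ 'v"
  assumes \<rho>: "\<rho> > 0" and a: "\<And>k. a $ k > 0" and T0: "\<And>k. T 0 $ k > 0"
    and step: "\<And>n k. T (Suc n) $ k = T n $ k * moment \<rho> k (T n) / moment \<rho> k a"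
  shows "T n $ k > 0" and "T \<longlonglongrightarrow> a"
proof -
  have M: "moment \<rho> k x > 0" for k and x :: "real ^ 'v"
    by (rule moment_pos[OF \<rho>])
  have T: "T n $ k > 0" for n k
    by (induction n) (auto simp: T0 step M)
  then show "T n $ k > 0" .
  define D where "D n = divergence \<rho> a (T n)" for n
  have dec: "2 * gap \<rho> a (T n) \<le> D n - D (Suc n)" for n
    unfolding D_def by (rule divergence_decrease[OF \<rho> a T step])
  have "decseq D"
  proof (rule decseq_SucI)
    show "D (Suc n) \<le> D n" for n
      using dec[of n] gap_nonneg[OF \<rho>, of a "T n"] by linarith
  qed
  have D0: "D n \<ge> 0" for n
    unfolding D_def by (rule divergence_nonneg[OF \<rho> a T])
  obtain D' where D': "D \<longlonglongrightarrow> D'"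
    using decseq_convergent[OF \<open>decseq D\<close>, of 0] D0 by blast
  have "(\<lambda>n. D n - D (Suc n)) \<longlonglongrightarrow> D' - D'"
    by (intro tendsto_diff D' LIMSEQ_Suc)
  then have diff0: "(\<lambda>n. D n - D (Suc n)) \<longlonglongrightarrow> 0" by simp
  have gap0: "(\<lambda>n. gap \<rho> a (T n)) \<longlonglongrightarrow> 0"
  proof (rule tendsto_sandwich[OF _ _ tendsto_const diff0])
    show "\<forall>\<^sub>F n in sequentially. 0 \<le> gap \<rho> a (T n)"
      by (simp add: gap_nonneg[OF \<rho>])
    have "gap \<rho> a (T n) \<le> D n - D (Suc n)" for n
      using dec[of n] gap_nonneg[OF \<rho>, of a "T n"] by linarith
    then show "\<forall>\<^sub>F n in sequentially. gap \<rho> a (T n) \<le> D n - D (Suc n)"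
      by simp
  qed
  \<comment> \<open>Each summand of the divergence is nonnegative, hence at most the whole sum,
    which never exceeds \<open>D 0\<close>; dividing by the positive factor
    \<open>moment \<rho> k a\<close> bounds the bare term.\<close>
  define C where "C k = D 0 / moment \<rho> k a" for k
  have term_le: "a $ k * ln (a $ k / T n $ k) - a $ k + T n $ k \<le> C k" for n k
  proof -
    have "moment \<rho> k a * (a $ k * ln (a $ k / T n $ k) - a $ k + T n $ k) \<le> D n"
      unfolding D_def divergence_def
      by (rule member_le_sum) (simp_all add: kl_term_nonneg a T less_imp_le M)
    also have "\<dots> \<le> D 0" using \<open>decseq D\<close> by (simp add: decseq_def)
    finally show ?thesis using M[of k a] by (simp add: C_def field_simps)
  qed
  define lo hi where "lo = (\<chi> k. a $ k * exp (- ((C k + a $ k) / a $ k)))" and "hi = (\<chi> k. 2 * (C k + a $ k))"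
  have box: "T n \<in> cbox lo hi" for n
    using kl_term_bounds[OF a T term_le] by (simp add: mem_box_cart lo_def hi_def)
  \<comment> \<open>By continuity a subsequential limit inherits a vanishing gap, which only
    \<open>a\<close> has.\<close>
  have sub: "l = a" if r: "strict_mono r" and l: "(T \<circ> r) \<longlonglongrightarrow> l" for r l
  proof (rule ccontr)
    assume "l \<noteq> a"
    have "(\<lambda>n. gap \<rho> a ((T \<circ> r) n)) \<longlonglongrightarrow> gap \<rho> a l"
      using T by (intro gap_tendsto \<rho> l) (simp add: less_imp_le)
    moreover have "(\<lambda>n. gap \<rho> a ((T \<circ> r) n)) \<longlonglongrightarrow> 0"
      using LIMSEQ_subseq_LIMSEQ[OF gap0 r] by (simp add: o_def)
    ultimately have "gap \<rho> a l = 0" by (rule LIMSEQ_unique)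
    then show False using gap_pos[OF \<rho> \<open>l \<noteq> a\<close>] by simp
  qed
  show "T \<longlonglongrightarrow> a"
  proof (rule ccontr)
    assume "\<not> T \<longlonglongrightarrow> a"
    then obtain e where e: "e > 0" "\<And>N. \<exists>n\<ge>N. \<not> dist (T n) a < e"
      unfolding lim_sequentially by blast
    \<comment> \<open>If convergence fails, infinitely many iterates stay at distance at least
      \<open>e\<close> from \<open>a\<close>. Enumerating them gives a subsequence in the box, and a
      convergent subsequence of it would have to tend to \<open>a\<close>.\<close>
    define S where "S = {n. \<not> dist (T n) a < e}"
    have S: "infinite S"
      unfolding infinite_nat_iff_unbounded_le S_def using e(2) by blast
    define r where "r = enumerate S"
    have r: "strict_mono r" "\<And>n. r n \<in> S"
      unfolding r_def using S by (auto intro: strict_mono_enumerate enumerate_in_set)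
    have "compact (cbox lo hi)" "\<forall>n. (T \<circ> r) n \<in> cbox lo hi" using box by auto
    then obtain l q where q: "strict_mono q" "((T \<circ> r) \<circ> q) \<longlonglongrightarrow> l"
      unfolding compact_eq_seq_compact_metric by (metis seq_compactE)
    have "l = a"
      using q(2) by (intro sub[OF strict_mono_o[OF r(1) q(1)]]) (simp only: o_assoc)
    then have "((T \<circ> r) \<circ> q) \<longlonglongrightarrow> a" using q(2) by simp
    then obtain n where "dist (((T \<circ> r) \<circ> q) n) a < e"
      using e(1) unfolding lim_sequentially by blast
    then show False using r(2)[of "q n"] by (simp add: S_def)
  qed
qed

section \<open>Translation back to the Gaussian integrals \<open>alpha\<close> and
  \<open>alpha_k\<close>\<close>

lemma prod_gauss:
  fixes l x :: "real ^ 'v"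
  shows "(\<Prod>m\<in>UNIV. gauss (x $ m) (l $ m)) = (\<Prod>m\<in>UNIV. 1 / sqrt (2 * pi * l $ m)) * weight (\<chi> k. 1 / l $ k) x"
proof -
  have "weight (\<chi> k. 1 / l $ k) x = exp (\<Sum>m\<in>UNIV. - ((x $ m)\<^sup>2 / (2 * l $ m)))"
    by (simp add: weight_def sum_divide_distrib sum_negf mult.commute)
  then show ?thesis
    by (simp add: gauss_def exp_sum flip: prod.distrib)
qed

text \<open>The normalising constant \<open>c\<close> cancels in the quotient, which lets the whole
  iteration be written with \<open>moment\<close> alone.\<close>

lemma alpha_ratio:
  fixes l :: "real ^ 'v"
  assumes \<rho>: "\<rho> > 0" and l: "\<And>k. l $ k > 0"
  shows "alpha_k k \<rho> l / alpha \<rho> l = moment \<rho> k (\<chi> k. 1 / l $ k) / l $ k" (is "_ = moment _ _ ?t / _")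
proof -
  define c where "c = (\<Prod>m\<in>UNIV. 1 / sqrt (2 * pi * l $ m))"
  have c: "c > 0" unfolding c_def using l by (intro prod_pos) auto
  have "alpha \<rho> l = c * partition_fn \<rho> ?t"
    by (simp add: alpha_def prod_gauss c_def partition_fn_def)
  moreover have "alpha_k k \<rho> l = (LINT x:sq_ball \<rho>|lborel. c / l $ k * ((x $ k)\<^sup>2 * weight ?t x))"
    by (simp add: alpha_k_def prod_gauss c_def mult_ac)
  then have "alpha_k k \<rho> l = c / l $ k * (moment \<rho> k ?t * partition_fn \<rho> ?t)"
    using partition_fn_pos[OF \<rho>, of ?t] by (simp add: moment_def)
  ultimately show ?thesis
    using c partition_fn_pos[OF \<rho>, of ?t] by simp
qed

theorem mainTheorem2:
  fixes \<rho> :: real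
    and lam \<mu> :: "real ^ 'v"
    and L :: "nat \<Rightarrow> real ^ 'v"
  assumes "\<rho> > 0"
    and "\<And>k. lam $ k > 0"
    and "\<And>k. \<mu> $ k = lam $ k * alpha_k k \<rho> lam / alpha \<rho> lam"
    and "L 0 = \<mu>"
    and "\<And>n k. L (Suc n) $ k = \<mu> $ k * (alpha \<rho> (L n) / alpha_k k \<rho> (L n))"
  shows "(\<forall>n k. L n $ k > 0) \<and> L \<longlonglongrightarrow> lam"
proof -
  define inv where "inv l = (\<chi> k. 1 / l $ k)" for l :: "real ^ 'v"
  note \<rho> = assms(1) and lam = assms(2)
  \<comment> \<open>The factor \<open>lam $ k\<close> cancels, so the given data are the second
    moments of the truncated Gaussian with variances \<open>lam\<close>.\<close>
  have \<mu>: "\<mu> $ k = moment \<rho> k (inv lam)" for k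
  proof -
    have "\<mu> $ k = lam $ k * (alpha_k k \<rho> lam / alpha \<rho> lam)"
      using assms(3)[of k] by simp
    then show ?thesis
      using lam[of k] unfolding alpha_ratio[OF \<rho> lam] by (simp add: inv_def)
  qed
  \<comment> \<open>Positivity of the current iterate is a premise because
    \<open>alpha_ratio\<close> requires it; the induction for \<open>pos\<close> supplies it along
    the way.\<close>
  have step: "L (Suc n) $ k = \<mu> $ k * (L n $ k / moment \<rho> k (inv (L n)))" if "\<And>k. L n $ k > 0" for n k
  proof -
    have "alpha \<rho> (L n) / alpha_k k \<rho> (L n) = inverse (alpha_k k \<rho> (L n) / alpha \<rho> (L n))"
      by simp
    then show ?thesis
      using alpha_ratio[OF \<rho> that, of k] by (simp add: assms(5) inv_def)
  qed
  have pos: "L n $ k > 0" for n k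
  proof (induction n arbitrary: k)
    case 0
    then show ?case by (simp add: assms(4) \<mu> moment_pos[OF \<rho>])
  next
    case (Suc n)
    show ?case using Suc by (simp add: step \<mu> moment_pos[OF \<rho>])
  qed
  \<comment> \<open>In reciprocals, division by the moment becomes multiplication, which is the form
    of the iteration treated above.\<close>
  define T where "T n = inv (L n)" for n
  have "T \<longlonglongrightarrow> inv lam"
  proof (rule multiplicative_iteration_converges(2)[OF \<rho>])
    show "inv lam $ k > 0" "T 0 $ k > 0" for k
      using lam pos by (simp_all add: inv_def T_def)
    show "T (Suc n) $ k = T n $ k * moment \<rho> k (T n) / moment \<rho> k (inv lam)" for n k
      using pos[of n k] moment_pos[OF \<rho>, of k "inv lam"] moment_pos[OF \<rho>, of k "T n"]
      by (simp add: T_def inv_def step[OF pos] \<mu>)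
  qed
  \<comment> \<open>The limit \<open>inv lam\<close> has nonzero components, so taking reciprocals
    again is continuous there.\<close>
  then have "(\<lambda>n. 1 / T n $ k) \<longlonglongrightarrow> 1 / inv lam $ k" for k
    using lam[of k] by (intro tendsto_divide tendsto_const tendsto_vec_nth) (auto simp: inv_def)
  then have "L \<longlonglongrightarrow> lam"
    by (intro vec_tendstoI) (simp add: T_def inv_def)
  with pos show ?thesis by blast
qed

end
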